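(* Let $n\ge 1$ and let $\mathcal{E}(n)$ be the set of isomorphism classes of simple graphs on $n$ vertices. For $0\le d\le \binom n2$ let $h(d)$ be the number of members of $\mathcal{E}(n)$ with exactly $d$ edges. Then there exists a set $\mathcal{S}\subseteq\mathcal{E}(n)$ with $|\mathcal{S}|\le h\left(\left\lfloor \binom n2/2\right\rfloor\right)$ which is a generator/separator set for $\mathcal{E}(n)$, i.e. the map $x\mapsto (I(s)(x))_{s\in\mathcal S}$ is injective on $\mathcal{E}(n)$ (equivalently, for every $g\in\mathcal{E}(n)$ there is a function $f$ with $I(g)(x)=f((I(s)(x))_{s\in\mathcal S})$ for all $x\in\mathcal{E}(n)$).
   Context: For simple graphs $g,x$ on $n$ vertices, $I(g)(x)$ is the number of subgraphs of $x$ (subsets of its edge set, on the same vertex set) isomorphic to $g$. *)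

theory Defs
  imports
    Complex_Main
    "HOL-Library.FuncSet"
    "HOL-Library.Ramsey"
    "HOL-Combinatorics.Permutations"
begin

text \<open>A simple graph on \<open>n\<close> vertices has vertex set \<open>{..<n}\<close> and is identified with its set of edges,
  a set of two-element subsets of \<open>{..<n}\<close>.\<close>

type_synonym graph = "nat set set"

definition simple_graphs :: "nat \<Rightarrow> graph set" where
  "simple_graphs n = Pow (nsets {..<n} 2)"

definition graph_iso :: "nat \<Rightarrow> graph rel" where
  "graph_iso n = {(G, H). G \<in> simple_graphs n \<and> H \<in> simple_graphs n \<and>
     (\<exists>p. p permutes {..<n} \<and> H = (\<lambda>e. p ` e) ` G)}"

definition iso_classes :: "nat \<Rightarrow> graph set set" where
  "iso_classes n = simple_graphs n // graph_iso n"

definition subgraph_count :: "nat \<Rightarrow> graph \<Rightarrow> graph \<Rightarrow> nat" where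
  "subgraph_count n G X = card {H. H \<subseteq> X \<and> (H, G) \<in> graph_iso n}"

text \<open>The two functions below are the liftings to isomorphism classes of \<open>card\<close> and
  \<^const>\<open>subgraph_count\<close>; they are evaluated at representatives, and
  \<open>class_edges_eq\<close> and \<open>class_count_eq\<close> show independence of the choice.\<close>

definition class_edges :: "graph set \<Rightarrow> nat" where
  "class_edges c = the_elem (\<Union>G\<in>c. {card G})"

definition class_count :: "nat \<Rightarrow> graph set \<Rightarrow> graph set \<Rightarrow> nat" where
  "class_count n g x = the_elem (\<Union>G\<in>g. \<Union>X\<in>x. {subgraph_count n G X})"

definition num_classes :: "nat \<Rightarrow> nat \<Rightarrow> nat" where
  "num_classes n d = card {c \<in> iso_classes n. class_edges c = d}"

definition count_vector :: "nat \<Rightarrow> graph set set \<Rightarrow> graph set \<Rightarrow> (graph set \<Rightarrow> nat)" where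
  "count_vector n S x = (\<lambda>s\<in>S. class_count n s x)"

definition is_separator :: "nat \<Rightarrow> graph set set \<Rightarrow> bool" where
  "is_separator n S \<longleftrightarrow> inj_on (count_vector n S) (iso_classes n)"

definition is_generator :: "nat \<Rightarrow> graph set set \<Rightarrow> bool" where
  "is_generator n S \<longleftrightarrow> (\<forall>g\<in>iso_classes n. \<exists>f :: (graph set \<Rightarrow> nat) \<Rightarrow> nat.
     \<forall>x\<in>iso_classes n. class_count n g x = f (count_vector n S x))"

lemma graph_iso_image:
  assumes "p permutes {..<n}" and "G \<in> simple_graphs n"
  shows "(\<lambda>e. p ` e) ` G \<in> simple_graphs n"
proof -
  have "p ` e \<in> nsets {..<n} 2" if "e \<in> nsets {..<n} 2" for e
    using that permutes_image[OF assms(1)] permutes_inj_on[OF assms(1), of e]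
    by (auto simp: nsets_def card_image)
  then show ?thesis
    using assms(2) by (auto simp: simple_graphs_def)
qed

lemma equiv_graph_iso: "equiv (simple_graphs n) (graph_iso n)"
proof (rule equivI)
  show "graph_iso n \<subseteq> simple_graphs n \<times> simple_graphs n"
    by (auto simp: graph_iso_def)
  show "refl_on (simple_graphs n) (graph_iso n)"
    by (auto simp: refl_on_def graph_iso_def intro!: exI[of _ id] permutes_id)
  show "sym (graph_iso n)"
  proof (rule symI)
    fix G H assume "(G, H) \<in> graph_iso n"
    then obtain p where p: "p permutes {..<n}" "H = (\<lambda>e. p ` e) ` G"
      and GH: "G \<in> simple_graphs n" "H \<in> simple_graphs n"
      by (auto simp: graph_iso_def)
    have "G = (\<lambda>e. inv p ` e) ` H"
      by (simp add: p(2) image_image permutes_inverses(2)[OF p(1)])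
    then show "(H, G) \<in> graph_iso n"
      using GH permutes_inv[OF p(1)] by (auto simp: graph_iso_def)
  qed
  show "trans (graph_iso n)"
  proof (rule transI)
    fix G H K assume "(G, H) \<in> graph_iso n" "(H, K) \<in> graph_iso n"
    then obtain p q where pq: "p permutes {..<n}" "q permutes {..<n}"
        "H = (\<lambda>e. p ` e) ` G" "K = (\<lambda>e. q ` e) ` H"
      and GK: "G \<in> simple_graphs n" "K \<in> simple_graphs n"
      by (auto simp: graph_iso_def)
    have "K = (\<lambda>e. (q \<circ> p) ` e) ` G"
      by (simp add: pq(3,4) image_image)
    then show "(G, K) \<in> graph_iso n"
      using GK permutes_compose[OF pq(1,2)] unfolding graph_iso_def by blast
  qed
qed

lemma finite_iso_classes: "finite (iso_classes n)"
  unfolding iso_classes_def quotient_def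
  by (simp add: simple_graphs_def finite_imp_finite_nsets)

lemma card_graph_iso:
  assumes "(G, H) \<in> graph_iso n" shows "card G = card H"
proof -
  obtain p where p: "p permutes {..<n}" "H = (\<lambda>e. p ` e) ` G"
    using assms by (auto simp: graph_iso_def)
  have "inj (\<lambda>e. p ` e)"
    by (rule inj_on_image[OF permutes_inj_on[OF p(1)]])
  then show ?thesis
    by (simp add: p(2) card_image inj_on_subset)
qed

lemma subgraph_count_le:
  assumes "(G, G') \<in> graph_iso n" and "(X, X') \<in> graph_iso n"
  shows "subgraph_count n G X \<le> subgraph_count n G' X'"
proof -
  note eq = equiv_graph_iso[of n]
  obtain p where p: "p permutes {..<n}" "X' = (\<lambda>e. p ` e) ` X" and X': "X' \<in> simple_graphs n"
    using assms(2) by (auto simp: graph_iso_def)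
  let ?f = "\<lambda>H. (\<lambda>e. p ` e) ` H"
  have "inj (\<lambda>e. p ` e)"
    by (rule inj_on_image[OF permutes_inj_on[OF p(1)]])
  then have inj: "inj ?f"
    by (rule inj_on_image[OF inj_on_subset, OF _ subset_UNIV])
  have maps: "?f H \<subseteq> X' \<and> (?f H, G') \<in> graph_iso n" if "H \<subseteq> X" "(H, G) \<in> graph_iso n" for H
  proof -
    have H: "H \<in> simple_graphs n"
      using that(2) by (auto simp: graph_iso_def)
    then have "(H, ?f H) \<in> graph_iso n"
      using graph_iso_image[OF p(1)] p(1) by (auto simp: graph_iso_def)
    then have "(?f H, G') \<in> graph_iso n"
      using that(2) assms(1) eq unfolding equiv_def by (meson symD transD)
    then show ?thesis using that(1) p(2) by auto
  qed
  have "finite X'"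
    using X' finite_subset[OF _ finite_imp_finite_nsets[of "{..<n}" 2]]
    by (simp add: simple_graphs_def)
  then have "finite {H. H \<subseteq> X' \<and> (H, G') \<in> graph_iso n}"
    by simp
  then show ?thesis
    unfolding subgraph_count_def using maps
    by (intro card_inj_on_le[OF inj_on_subset[OF inj subset_UNIV]]) blast+
qed

lemma class_rel:
  assumes "c \<in> iso_classes n" "G \<in> c" "H \<in> c"
  shows "(G, H) \<in> graph_iso n"
  using assms quotient_eq_iff[OF equiv_graph_iso] unfolding iso_classes_def by blast

lemma class_edges_eq:
  assumes "c \<in> iso_classes n" "G \<in> c"
  shows "class_edges c = card G"
proof -
  have "(\<Union>H\<in>c. {card H}) = {card G}"
    using assms card_graph_iso[OF class_rel[OF assms(1)]] by blast
  then show ?thesis by (simp add: class_edges_def)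
qed

lemma class_count_eq:
  assumes "g \<in> iso_classes n" "x \<in> iso_classes n" "G \<in> g" "X \<in> x"
  shows "class_count n g x = subgraph_count n G X"
proof -
  have "subgraph_count n G' X' = subgraph_count n G X" if "G' \<in> g" "X' \<in> x" for G' X'
    using assms that by (meson class_rel subgraph_count_le le_antisym)
  then have "(\<Union>G\<in>g. \<Union>X\<in>x. {subgraph_count n G X}) = {subgraph_count n G X}"
    using assms by blast
  then show ?thesis by (simp add: class_count_def)
qed

end

theory Submission imports Defs begin

text \<open>Let \<open>N = n choose 2\<close>. For \<open>2 * k < N\<close> the matrix of the counts \<open>I(g)(c)\<close>, with \<open>g\<close> of \<open>k\<close> and
  \<open>c\<close> of \<open>k + 1\<close> edges, has independent rows, because a function on the \<open>k\<close>-subsets of an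
  \<open>N\<close>-set whose sums over all \<open>(k + 1)\<close>-subsets vanish is zero. By Kelly's lemma the number of
  edges of \<open>x\<close> and the counts in \<open>x\<close> of the graphs with \<open>k\<close> edges determine the product of this
  matrix with the vector of the counts of the graphs with \<open>k + 1\<close> edges, so it suffices to
  record \<open>h (k + 1) - h k\<close> of the latter. Summing over \<open>k < N div 2\<close> gives
  \<open>h (N div 2) - h 0\<close> recorded counts; the number of edges costs one more, and \<open>h 0 = 1\<close>.

  These data determine all counts of graphs with at most \<open>N div 2\<close> edges, hence \<open>x\<close> itself if
  \<open>x\<close> has at most that many edges. Otherwise the complement of \<open>x\<close> has at most \<open>N div 2\<close> edges,
  and counts in the complement are obtained by inclusion-exclusion.\<close>

section \<open>Sums over the \<open>k\<close>-subsets of a finite set\<close>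

lemma sum_Pow_neg_one_power_card:
  assumes "finite A"
  shows "(\<Sum>T\<in>Pow A. (-1) ^ card T) = (if A = {} then 1 else 0 :: real)"
proof (cases "A = {}")
  case False
  have "(\<Prod>x\<in>A. 1 - 1 :: real) = (\<Sum>T\<in>Pow A. (-1) ^ card T * (\<Prod>x\<in>T. 1) * (\<Prod>x\<in>A-T. 1))"
    by (rule prod_diff_conv_sum) (rule assms)
  then show ?thesis using False assms by (simp add: power_0_left)
qed simp

lemma card_nsets_Suc_supersets:
  assumes "finite X" "G \<in> nsets X k"
  shows "card {Y \<in> nsets X (Suc k). G \<subseteq> Y} = card X - k"
proof -
  have G: "G \<subseteq> X" "card G = k" "finite G" using assms(2) by (auto simp: nsets_def)
  have "{Y \<in> nsets X (Suc k). G \<subseteq> Y} = (\<lambda>a. insert a G) ` (X - G)"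
  proof (intro equalityI subsetI)
    fix Y assume "Y \<in> {Y \<in> nsets X (Suc k). G \<subseteq> Y}"
    then have Y: "Y \<subseteq> X" "finite Y" "card Y = Suc k" "G \<subseteq> Y" by (auto simp: nsets_def)
    then have "card (Y - G) = 1" using G by (simp add: card_Diff_subset)
    then obtain a where "Y - G = {a}" by (auto simp: card_1_singleton_iff)
    then show "Y \<in> (\<lambda>a. insert a G) ` (X - G)" using Y by blast
  qed (use G in \<open>auto simp: nsets_def\<close>)
  moreover have "inj_on (\<lambda>a. insert a G) (X - G)" by (auto simp: inj_on_def)
  ultimately show ?thesis using G assms(1) by (simp add: card_image card_Diff_subset)
qed

text \<open>Double counting: each \<open>k\<close>-subset of \<open>X\<close> lies in exactly
  \<open>card X - k\<close> subsets of size \<open>Suc k\<close>.\<close>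

lemma sum_nsets_Suc:
  fixes f :: "'a set \<Rightarrow> real"
  assumes "finite X"
  shows "(\<Sum>Y\<in>nsets X (Suc k). \<Sum>G\<in>nsets Y k. f G) = real (card X - k) * (\<Sum>G\<in>nsets X k. f G)"
proof -
  have fin: "finite (nsets X k)" "finite (nsets X (Suc k))"
    using assms by (auto intro: finite_imp_finite_nsets)
  have "nsets Y k = {G \<in> nsets X k. G \<subseteq> Y}" if "Y \<in> nsets X (Suc k)" for Y
    using that by (auto simp: nsets_def)
  then have "(\<Sum>Y\<in>nsets X (Suc k). \<Sum>G\<in>nsets Y k. f G)
      = (\<Sum>Y\<in>nsets X (Suc k). \<Sum>G | G \<in> nsets X k \<and> G \<subseteq> Y. f G)"
    by (intro sum.cong) auto
  also have "\<dots> = (\<Sum>G\<in>nsets X k. \<Sum>Y | Y \<in> nsets X (Suc k) \<and> G \<subseteq> Y. f G)"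
    using fin by (subst sum.swap_restrict) auto
  also have "\<dots> = (\<Sum>G\<in>nsets X k. real (card X - k) * f G)"
    using card_nsets_Suc_supersets[OF assms] by (intro sum.cong) auto
  finally show ?thesis by (simp add: sum_distrib_left)
qed

text \<open>For \<open>T \<subseteq> F\<close>, adding up the hypothesis over all
  \<open>(Suc k)\<close>-subsets of \<open>E - T\<close> shows that \<open>a\<close> sums to zero
  over the \<open>k\<close>-subsets that avoid \<open>T\<close>. Inclusion-exclusion over
  \<open>T\<close> then leaves those that contain \<open>F\<close>, and \<open>F\<close> is the only
  one.\<close>

lemma nsets_sums_Suc_zero_imp_zero:
  fixes a :: "'a set \<Rightarrow> real"
  assumes E: "finite E" "2 * k < card E"
    and zero: "\<And>Y. Y \<in> nsets E (Suc k) \<Longrightarrow> (\<Sum>G\<in>nsets Y k. a G) = 0"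
    and F: "F \<in> nsets E k"
  shows "a F = 0"
proof -
  have F': "F \<subseteq> E" "finite F" "card F = k" using F by (auto simp: nsets_def)
  have fin: "finite (nsets E k)" using E by (simp add: finite_imp_finite_nsets)
  have avoid: "(\<Sum>G | G \<in> nsets E k \<and> G \<inter> T = {}. a G) = 0" if "T \<subseteq> F" for T
  proof -
    let ?X = "E - T"
    have T: "finite T" "T \<subseteq> E" "card T \<le> k"
      using that F' finite_subset by (auto intro: card_mono)
    \<comment> \<open>As \<open>card T \<le> k\<close> and \<open>2 * k < card E\<close>, the factor
      \<open>card ?X - k\<close> in the double count is nonzero.\<close>
    have "card ?X > k" using T E by (simp add: card_Diff_subset)
    have "nsets ?X (Suc k) \<subseteq> nsets E (Suc k)" by (rule nsets_mono) auto
    then have "(\<Sum>Y\<in>nsets ?X (Suc k). \<Sum>G\<in>nsets Y k. a G) = 0"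
      using zero by (intro sum.neutral) auto
    then have "(\<Sum>G\<in>nsets ?X k. a G) = 0"
      using sum_nsets_Suc[of ?X a k] E \<open>card ?X > k\<close> by simp
    moreover have "nsets ?X k = {G. G \<in> nsets E k \<and> G \<inter> T = {}}"
      by (auto simp: nsets_def)
    ultimately show ?thesis by simp
  qed
  have "0 = (\<Sum>T\<in>Pow F. (-1) ^ card T * (\<Sum>G | G \<in> nsets E k \<and> G \<inter> T = {}. a G))"
    using avoid by simp
  also have "\<dots> = (\<Sum>T\<in>Pow F. \<Sum>G | G \<in> nsets E k \<and> G \<inter> T = {}. (-1) ^ card T * a G)"
    by (simp add: sum_distrib_left)
  also have "\<dots> = (\<Sum>G\<in>nsets E k. \<Sum>T | T \<in> Pow F \<and> G \<inter> T = {}. (-1) ^ card T * a G)"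
    using fin F' by (subst sum.swap_restrict) auto
  also have "\<dots> = (\<Sum>G\<in>nsets E k. (\<Sum>T\<in>Pow (F - G). (-1) ^ card T) * a G)"
    unfolding sum_distrib_right by (intro sum.cong) auto
  also have "\<dots> = (\<Sum>G\<in>nsets E k. if G = F then a G else 0)"
  proof (intro sum.cong refl)
    fix G assume "G \<in> nsets E k"
    \<comment> \<open>Both sets have \<open>k\<close> elements, so \<open>F \<subseteq> G\<close>
      forces equality.\<close>
    then have "F - G = {} \<longleftrightarrow> G = F"
      using F' by (auto simp: nsets_def) (metis card_subset_eq subsetD subsetI)
    then show "(\<Sum>T\<in>Pow (F - G). (-1) ^ card T) * a G = (if G = F then a G else 0)"
      using sum_Pow_neg_one_power_card[of "F - G"] F' by simp
  qed
  also have "\<dots> = a F" using fin F by simp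
  finally show ?thesis by simp
qed

section \<open>Determining columns of a matrix with independent rows\<close>

text \<open>One step of Gaussian elimination per row; \<open>S\<close> is the complement of the set of pivot columns.\<close>

lemma ex_determining_columns:
  fixes M :: "'r \<Rightarrow> 'c \<Rightarrow> real"
  assumes "finite R" "finite C"
    and "\<And>a. (\<forall>c\<in>C. (\<Sum>r\<in>R. a r * M r c) = 0) \<Longrightarrow> \<forall>r\<in>R. a r = 0"
  shows "\<exists>S\<subseteq>C. card S + card R = card C \<and>
    (\<forall>u. (\<forall>r\<in>R. (\<Sum>c\<in>C. M r c * u c) = 0) \<longrightarrow> (\<forall>c\<in>S. u c = 0) \<longrightarrow> (\<forall>c\<in>C. u c = 0))"
  using assms
proof (induction R arbitrary: C M rule: finite_induct)
  case empty
  then show ?case by (intro exI[of _ C]) auto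
next
  case (insert r R)
  note ind = insert.prems(2)
  \<comment> \<open>A zero row would give a nontrivial relation with coefficient 1 at
    \<open>r\<close>.\<close>
  have "\<exists>c\<in>C. M r c \<noteq> 0"
  proof (rule ccontr)
    assume "\<not> (\<exists>c\<in>C. M r c \<noteq> 0)"
    then have "\<forall>c\<in>C. (\<Sum>r'\<in>insert r R. (if r' = r then 1 else 0) * M r' c) = 0"
      by (auto intro!: sum.neutral)
    from ind[OF this] show False by auto
  qed
  then obtain c where c: "c \<in> C" "M r c \<noteq> 0" by blast
  define q where "q r' = M r' c / M r c" for r'
  define M' where "M' r' c' = M r' c' - q r' * M r c'" for r' c'
  have M'c: "M' r' c = 0" for r' using c by (simp add: M'_def q_def)
  have ind': "\<forall>r'\<in>R. a r' = 0" if a: "\<forall>c'\<in>C - {c}. (\<Sum>r'\<in>R. a r' * M' r' c') = 0" for a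
  proof -
    \<comment> \<open>The coefficient of row \<open>r\<close> is chosen so that combining
      \<open>M\<close> with \<open>b\<close> gives the same as combining \<open>M'\<close> with
      \<open>a\<close>.\<close>
    define b where "b r' = (if r' = r then - (\<Sum>r'\<in>R. a r' * q r') else a r')" for r'
    have "(\<Sum>r'\<in>insert r R. b r' * M r' c') = 0" if "c' \<in> C" for c'
    proof -
      have "(\<Sum>r'\<in>R. b r' * M r' c') = (\<Sum>r'\<in>R. a r' * M r' c')"
        using insert.hyps by (intro sum.cong) (auto simp: b_def)
      then have "(\<Sum>r'\<in>insert r R. b r' * M r' c') = (\<Sum>r'\<in>R. a r' * M' r' c')"
        using insert.hyps
        by (simp add: M'_def b_def algebra_simps sum_subtractf sum_distrib_right sum_distrib_left)
      also have "\<dots> = 0" using a M'c that by (cases "c' = c") auto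
      finally show ?thesis .
    qed
    then have "\<forall>r'\<in>insert r R. b r' = 0" by (intro ind) blast
    then show ?thesis using insert.hyps by (auto simp: b_def split: if_splits)
  qed
  have "\<exists>S\<subseteq>C - {c}. card S + card R = card (C - {c}) \<and>
    (\<forall>u. (\<forall>r\<in>R. (\<Sum>c\<in>C - {c}. M' r c * u c) = 0) \<longrightarrow> (\<forall>c\<in>S. u c = 0) \<longrightarrow>
      (\<forall>c\<in>C - {c}. u c = 0))"
  proof (rule insert.IH)
    show "finite (C - {c})" using insert.prems by simp
  qed (rule ind')
  then obtain S where S: "S \<subseteq> C - {c}" "card S + card R = card (C - {c})"
    and det: "\<forall>u. (\<forall>r\<in>R. (\<Sum>c\<in>C - {c}. M' r c * u c) = 0) \<longrightarrow> (\<forall>c\<in>S. u c = 0) \<longrightarrow>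
      (\<forall>c\<in>C - {c}. u c = 0)"
    by (elim exE conjE) (rule that)
  have "card S + card (insert r R) = card C"
    using S c insert by (simp add: card_Diff_singleton) (metis Suc_pred card_gt_0_iff empty_iff)
  moreover have "\<forall>c\<in>C. u c = 0"
    if u: "\<forall>r\<in>insert r R. (\<Sum>c\<in>C. M r c * u c) = 0" "\<forall>c\<in>S. u c = 0" for u
  proof -
    have "(\<Sum>c'\<in>C - {c}. M' r' c' * u c') = 0" if "r' \<in> R" for r'
    proof -
      have "(\<Sum>c'\<in>C - {c}. M' r' c' * u c') = (\<Sum>c'\<in>C. M' r' c' * u c')"
        using insert.prems c M'c by (simp add: sum.remove[of C c])
      also have "\<dots> = (\<Sum>c'\<in>C. M r' c' * u c') - q r' * (\<Sum>c'\<in>C. M r c' * u c')"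
        by (simp add: M'_def algebra_simps sum_subtractf sum_distrib_left)
      finally show ?thesis using u that by simp
    qed
    then have *: "\<forall>c\<in>C - {c}. u c = 0" using det u(2) by blast
    \<comment> \<open>Only the pivot term of row \<open>r\<close> survives, and its coefficient is
      nonzero.\<close>
    moreover have "(\<Sum>c'\<in>C. M r c' * u c') = M r c * u c"
      using insert.prems c * by (simp add: sum.remove[of C c])
    ultimately show ?thesis using u(1) c by auto
  qed
  ultimately show ?case using S(1) by (intro exI[of _ S]) auto
qed

section \<open>Isomorphism classes and their counts\<close>

definition class_of :: "nat \<Rightarrow> graph \<Rightarrow> graph set" where
  "class_of n G = graph_iso n `` {G}"

definition edge_classes :: "nat \<Rightarrow> nat \<Rightarrow> graph set set" where
  "edge_classes n d = {c \<in> iso_classes n. class_edges c = d}"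

lemma num_classes_eq: "num_classes n d = card (edge_classes n d)"
  by (simp add: num_classes_def edge_classes_def)

lemma finite_edge_classes [simp]: "finite (edge_classes n d)"
  by (simp add: edge_classes_def finite_iso_classes)

lemma edge_classesD:
  assumes "c \<in> edge_classes n d"
  shows "c \<in> iso_classes n" "class_edges c = d"
  using assms by (auto simp: edge_classes_def)

lemma finite_simple_graph: "G \<in> simple_graphs n \<Longrightarrow> finite G"
  by (auto simp: simple_graphs_def intro: finite_subset finite_imp_finite_nsets)

lemma simple_graphs_mono: "H \<subseteq> G \<Longrightarrow> G \<in> simple_graphs n \<Longrightarrow> H \<in> simple_graphs n"
  by (auto simp: simple_graphs_def)

lemma class_of_in_iso_classes: "G \<in> simple_graphs n \<Longrightarrow> class_of n G \<in> iso_classes n"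
  by (auto simp: class_of_def iso_classes_def intro: quotientI)

lemma mem_class_of: "G \<in> simple_graphs n \<Longrightarrow> G \<in> class_of n G"
  unfolding class_of_def by (rule equiv_class_self[OF equiv_graph_iso])

lemma iso_class_subset: "c \<in> iso_classes n \<Longrightarrow> c \<subseteq> simple_graphs n"
  unfolding iso_classes_def by (rule in_quotient_imp_subset[OF equiv_graph_iso])

lemma iso_class_nonempty: "c \<in> iso_classes n \<Longrightarrow> \<exists>G. G \<in> c"
  unfolding iso_classes_def using in_quotient_imp_non_empty[OF equiv_graph_iso] by blast

lemma finite_iso_class: "c \<in> iso_classes n \<Longrightarrow> finite c"
  by (rule finite_subset[OF iso_class_subset])
    (auto simp: simple_graphs_def finite_imp_finite_nsets)

lemma mem_iso_class_iff:
  assumes "c \<in> iso_classes n" "G \<in> c"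
  shows "H \<in> c \<longleftrightarrow> (H, G) \<in> graph_iso n"
proof
  assume "(H, G) \<in> graph_iso n"
  then have "(G, H) \<in> graph_iso n"
    using equiv_graph_iso[of n] by (meson equivE symD)
  then show "H \<in> c"
    using assms in_quotient_imp_closed[OF equiv_graph_iso] unfolding iso_classes_def by blast
qed (use assms in \<open>auto dest: class_rel\<close>)

lemma class_of_eq_iff:
  assumes "c \<in> iso_classes n" "G \<in> simple_graphs n"
  shows "class_of n G = c \<longleftrightarrow> G \<in> c"
proof
  assume "G \<in> c"
  then show "class_of n G = c"
    using assms(1) quotient_eqI[OF equiv_graph_iso, of "class_of n G" n c G G]
      class_of_in_iso_classes[OF assms(2)] mem_class_of[OF assms(2)] class_rel[OF assms(1)]
    unfolding iso_classes_def by blast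
qed (use assms mem_class_of in auto)

lemma class_edges_class_of: "G \<in> simple_graphs n \<Longrightarrow> class_edges (class_of n G) = card G"
  by (rule class_edges_eq[OF class_of_in_iso_classes mem_class_of])

lemma class_count_eq_card:
  assumes "g \<in> iso_classes n" "x \<in> iso_classes n" "X \<in> x"
  shows "class_count n g x = card {H \<in> g. H \<subseteq> X}"
proof -
  obtain G where G: "G \<in> g" using iso_class_nonempty assms(1) by blast
  have "{H. H \<subseteq> X \<and> (H, G) \<in> graph_iso n} = {H \<in> g. H \<subseteq> X}"
    using mem_iso_class_iff[OF assms(1) G] by blast
  then show ?thesis using class_count_eq[OF assms(1,2) G assms(3)] by (simp add: subgraph_count_def)
qed

section \<open>Linear relations between counts\<close>

text \<open>Grouping the subgraphs of a representative by their class turns weighted sums over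
  classes into sums over labelled graphs.\<close>

lemma sum_class_count:
  fixes \<phi> :: "graph set \<Rightarrow> real"
  assumes "C \<subseteq> iso_classes n" "x \<in> iso_classes n" "X \<in> x"
  shows "(\<Sum>c\<in>C. real (class_count n c x) * \<phi> c)
    = (\<Sum>H | H \<subseteq> X \<and> class_of n H \<in> C. \<phi> (class_of n H))"
proof -
  let ?S = "{H. H \<subseteq> X \<and> class_of n H \<in> C}"
  have X: "X \<in> simple_graphs n" using assms iso_class_subset by blast
  have fin: "finite ?S" "finite C"
    using finite_simple_graph[OF X] finite_subset[OF assms(1) finite_iso_classes] by auto
  have "real (class_count n c x) * \<phi> c = (\<Sum>H | H \<in> ?S \<and> class_of n H = c. \<phi> (class_of n H))"
    if c: "c \<in> C" for c
  proof -
    have "{H \<in> c. H \<subseteq> X} = {H. H \<in> ?S \<and> class_of n H = c}"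
      using c assms(1) class_of_eq_iff simple_graphs_mono[OF _ X] by blast
    then have "class_count n c x = card {H. H \<in> ?S \<and> class_of n H = c}"
      using class_count_eq_card[of c n x X] c assms by auto
    then show ?thesis by simp
  qed
  then have "(\<Sum>c\<in>C. real (class_count n c x) * \<phi> c)
      = (\<Sum>c\<in>C. \<Sum>H | H \<in> ?S \<and> class_of n H = c. \<phi> (class_of n H))"
    by (rule sum.cong[OF refl])
  also have "\<dots> = (\<Sum>H\<in>?S. \<phi> (class_of n H))"
    by (rule sum.group) (use fin in auto)
  finally show ?thesis .
qed

text \<open>Subgraphs with \<open>d\<close> edges are just \<open>d\<close>-subsets of the edge set,
  so facts about \<open>nsets\<close> apply to counts.\<close>

lemma sum_class_count_edge_classes:
  fixes \<phi> :: "graph set \<Rightarrow> real"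
  assumes "x \<in> iso_classes n" "X \<in> x"
  shows "(\<Sum>c\<in>edge_classes n d. real (class_count n c x) * \<phi> c)
    = (\<Sum>H\<in>nsets X d. \<phi> (class_of n H))"
proof -
  have X: "X \<in> simple_graphs n" using assms iso_class_subset by blast
  have "{H. H \<subseteq> X \<and> class_of n H \<in> edge_classes n d} = nsets X d"
    using simple_graphs_mono[OF _ X] finite_simple_graph
    by (auto simp: edge_classes_def nsets_def class_of_in_iso_classes class_edges_class_of)
  then show ?thesis
    using sum_class_count[of "edge_classes n d" n x X \<phi>] assms
    by (auto simp: edge_classes_def)
qed

text \<open>Kelly's lemma.\<close>

lemma sum_class_count_mult_class_count:
  assumes g: "g \<in> edge_classes n k" and x: "x \<in> iso_classes n"
  shows "(\<Sum>c\<in>edge_classes n (Suc k). real (class_count n g c) * real (class_count n c x))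
    = real (class_edges x - k) * real (class_count n g x)"
proof -
  obtain X where X: "X \<in> x" using iso_class_nonempty x by blast
  have Xs: "X \<in> simple_graphs n" using X x iso_class_subset by blast
  \<comment> \<open>Written as a sum over \<open>k\<close>-subsets, so that
    \<open>sum_nsets_Suc\<close> counts the chains \<open>K \<subseteq> H \<subseteq> X\<close> in
    both orders.\<close>
  have count: "real (class_count n g (class_of n H)) = (\<Sum>K\<in>nsets H k. of_bool (K \<in> g))"
    if H: "H \<in> simple_graphs n" for H
  proof -
    have "{K \<in> g. K \<subseteq> H} = {K \<in> nsets H k. K \<in> g}"
      using class_edges_eq[OF edge_classesD(1)[OF g]] edge_classesD(2)[OF g]
        finite_simple_graph[OF simple_graphs_mono[OF _ H]] by (auto simp: nsets_def)
    moreover have "finite (nsets H k)"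
      using finite_simple_graph[OF H] by (rule finite_imp_finite_nsets)
    ultimately show ?thesis
      using class_count_eq_card[OF edge_classesD(1)[OF g] class_of_in_iso_classes[OF H]
          mem_class_of[OF H]]
      by (simp add: of_bool_def sum.If_cases Int_def)
  qed
  have "(\<Sum>c\<in>edge_classes n (Suc k). real (class_count n g c) * real (class_count n c x))
      = (\<Sum>H\<in>nsets X (Suc k). real (class_count n g (class_of n H)))"
    using sum_class_count_edge_classes[OF x X, of "\<lambda>c. real (class_count n g c)"]
    by (simp add: mult.commute)
  also have "\<dots> = (\<Sum>H\<in>nsets X (Suc k). \<Sum>K\<in>nsets H k. of_bool (K \<in> g))"
    using simple_graphs_mono[OF _ Xs] by (intro sum.cong count) (auto simp: nsets_def)
  also have "\<dots> = real (card X - k) * (\<Sum>K\<in>nsets X k. of_bool (K \<in> g))"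
    by (rule sum_nsets_Suc[OF finite_simple_graph[OF Xs]])
  also have "\<dots> = real (class_edges x - k) * real (class_count n g x)"
    using count[OF Xs] class_of_eq_iff[OF x Xs] X class_edges_eq[OF x X] by simp
  finally show ?thesis .
qed

text \<open>The coefficients \<open>a\<close> induce the function
  \<open>G \<mapsto> a (class_of n G)\<close> on \<open>k\<close>-sets of edges. A vanishing
  combination in the column of the class of \<open>Y\<close> says that this function sums to zero
  over the \<open>k\<close>-subsets of \<open>Y\<close>, so
  \<open>nsets_sums_Suc_zero_imp_zero\<close> applies to the set of all \<open>n choose 2\<close>
  possible edges.\<close>

lemma class_count_rows_independent:
  fixes a :: "graph set \<Rightarrow> real"
  assumes "2 * k < n choose 2"
    and zero: "\<forall>c\<in>edge_classes n (Suc k). (\<Sum>g\<in>edge_classes n k. a g * real (class_count n g c)) = 0"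
  shows "\<forall>g\<in>edge_classes n k. a g = 0"
proof
  let ?E = "nsets {..<n} 2"
  fix g assume g: "g \<in> edge_classes n k"
  obtain G where G: "G \<in> g" using iso_class_nonempty edge_classesD(1)[OF g] by blast
  have Gs: "G \<in> simple_graphs n" using G iso_class_subset edge_classesD(1)[OF g] by blast
  have "card G = k" using class_edges_eq edge_classesD[OF g] G by force
  have "(\<Sum>H\<in>nsets Y k. a (class_of n H)) = 0" if Y: "Y \<in> nsets ?E (Suc k)" for Y
  proof -
    have Ys: "Y \<in> simple_graphs n" and "card Y = Suc k"
      using Y by (auto simp: nsets_def simple_graphs_def)
    then have "class_of n Y \<in> edge_classes n (Suc k)"
      by (simp add: edge_classes_def class_of_in_iso_classes class_edges_class_of)
    then show ?thesis
      using zero sum_class_count_edge_classes[OF class_of_in_iso_classes[OF Ys] mem_class_of[OF Ys], of a k]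
      by (simp add: mult.commute)
  qed
  then have "a (class_of n G) = 0"
  proof (rule nsets_sums_Suc_zero_imp_zero[of ?E k, rotated 2])
    show "G \<in> nsets ?E k"
      using Gs \<open>card G = k\<close> finite_simple_graph[OF Gs] by (auto simp: nsets_def simple_graphs_def)
  qed (use assms in \<open>auto simp: finite_imp_finite_nsets\<close>)
  then show "a g = 0" using class_of_eq_iff[OF edge_classesD(1)[OF g] Gs] G by simp
qed

section \<open>Complements and determination by small subgraphs\<close>

lemma graph_iso_imageE:
  assumes "(G, H) \<in> graph_iso n"
  obtains p where "p permutes {..<n}" "H = (\<lambda>e. p ` e) ` G" "inj (\<lambda>e. p ` e)"
proof -
  obtain p where p: "p permutes {..<n}" "H = (\<lambda>e. p ` e) ` G"
    using assms by (auto simp: graph_iso_def)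
  moreover have "inj (\<lambda>e. p ` e)"
    by (rule inj_on_image[OF permutes_inj_on[OF p(1)]])
  ultimately show thesis by (rule that)
qed

text \<open>A vertex permutation taking \<open>F\<close> to \<open>F'\<close> maps the supergraphs
  injectively within \<open>g\<close>. By symmetry their number depends only on the class of
  \<open>F\<close>.\<close>

lemma card_supergraphs_le:
  assumes g: "g \<in> iso_classes n" and F: "(F, F') \<in> graph_iso n"
  shows "card {K \<in> g. F \<subseteq> K} \<le> card {K \<in> g. F' \<subseteq> K}"
proof -
  obtain p where p: "p permutes {..<n}" "F' = (\<lambda>e. p ` e) ` F" "inj (\<lambda>e. p ` e)"
    using F by (rule graph_iso_imageE)
  show ?thesis
  proof (rule card_inj_on_le)
    show "inj_on (\<lambda>K. (\<lambda>e. p ` e) ` K) {K \<in> g. F \<subseteq> K}"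
      by (rule inj_on_image[OF inj_on_subset[OF p(3) subset_UNIV]])
    have "(\<lambda>e. p ` e) ` K \<in> g" if K: "K \<in> g" for K
    proof -
      have Ks: "K \<in> simple_graphs n" using K iso_class_subset[OF g] by blast
      then have "(K, (\<lambda>e. p ` e) ` K) \<in> graph_iso n"
        using p(1) graph_iso_image[OF p(1)] unfolding graph_iso_def by blast
      then show ?thesis
        using mem_iso_class_iff[OF g K] equiv_graph_iso[of n] by (meson equivE symD)
    qed
    then show "(\<lambda>K. (\<lambda>e. p ` e) ` K) ` {K \<in> g. F \<subseteq> K} \<subseteq> {K \<in> g. F' \<subseteq> K}"
      using p(2) by auto
    show "finite {K \<in> g. F' \<subseteq> K}" using finite_iso_class[OF g] by simp
  qed
qed

text \<open>Inclusion-exclusion over the common edges of \<open>K\<close> and \<open>X\<close>.\<close>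

lemma complement_count_linear:
  assumes g: "g \<in> iso_classes n"
  obtains \<phi> :: "graph set \<Rightarrow> real" where
    "\<And>x X. x \<in> iso_classes n \<Longrightarrow> X \<in> x \<Longrightarrow> real (card {K \<in> g. K \<inter> X = {}})
      = (\<Sum>c | c \<in> iso_classes n \<and> class_edges c \<le> class_edges g. real (class_count n c x) * \<phi> c)"
proof -
  \<comment> \<open>The total weight of \<open>F\<close> in the inclusion-exclusion sum: each
    \<open>K\<close> in \<open>g\<close> containing \<open>F\<close> contributes the sign of
    \<open>F\<close>.\<close>
  define \<psi> where "\<psi> F = (-1) ^ card F * real (card {K \<in> g. F \<subseteq> K})" for F :: graph
  have \<psi>: "\<psi> F = \<psi> F'" if "(F, F') \<in> graph_iso n" for F F'
  proof -
    have "(F', F) \<in> graph_iso n" using that equiv_graph_iso[of n] by (meson equivE symD)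
    then have "card {K \<in> g. F \<subseteq> K} = card {K \<in> g. F' \<subseteq> K}"
      using that by (intro le_antisym card_supergraphs_le[OF g])
    then show ?thesis
      using card_graph_iso[OF that] by (simp add: \<psi>_def)
  qed
  \<comment> \<open>The choice is harmless because \<open>\<psi>\<close> is invariant under
    isomorphism.\<close>
  define \<phi> where "\<phi> c = \<psi> (SOME F. F \<in> c)" for c
  have \<phi>: "\<phi> (class_of n F) = \<psi> F" if "F \<in> simple_graphs n" for F
  proof -
    have "(SOME F'. F' \<in> class_of n F) \<in> class_of n F"
      using mem_class_of[OF that] by (rule someI)
    then have "(SOME F'. F' \<in> class_of n F, F) \<in> graph_iso n"
      using class_rel[OF class_of_in_iso_classes[OF that]] mem_class_of[OF that] by simp
    then show ?thesis unfolding \<phi>_def by (rule \<psi>)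
  qed
  let ?C = "{c. c \<in> iso_classes n \<and> class_edges c \<le> class_edges g}"
  have "real (card {K \<in> g. K \<inter> X = {}}) = (\<Sum>c\<in>?C. real (class_count n c x) * \<phi> c)"
    if x: "x \<in> iso_classes n" "X \<in> x" for x X
  proof -
    have Xs: "X \<in> simple_graphs n" using x iso_class_subset by blast
    have sub: "F \<in> simple_graphs n" if "F \<subseteq> X" for F
      using simple_graphs_mono[OF that Xs] .
    have fin: "finite X" "finite g" using finite_simple_graph[OF Xs] finite_iso_class[OF g] by auto
    have "real (card {K \<in> g. K \<inter> X = {}}) = (\<Sum>K\<in>g. if X \<inter> K = {} then 1 else 0)"
      using fin by (simp add: sum.If_cases Int_def conj_commute)
    also have "\<dots> = (\<Sum>K\<in>g. \<Sum>F\<in>Pow (X \<inter> K). (-1) ^ card F)"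
      using fin by (intro sum.cong refl) (subst sum_Pow_neg_one_power_card, auto)
    also have "\<dots> = (\<Sum>K\<in>g. \<Sum>F | F \<in> Pow X \<and> F \<subseteq> K. (-1) ^ card F)"
      by (intro sum.cong) auto
    also have "\<dots> = (\<Sum>F\<in>Pow X. \<Sum>K | K \<in> g \<and> F \<subseteq> K. (-1) ^ card F)"
      using fin by (subst sum.swap_restrict) auto
    also have "\<dots> = (\<Sum>F\<in>Pow X. \<psi> F)"
      by (simp add: \<psi>_def mult.commute)
    also have "\<dots> = (\<Sum>F | F \<subseteq> X \<and> class_of n F \<in> ?C. \<psi> F)"
    proof (rule sum.mono_neutral_right)
      \<comment> \<open>An \<open>F\<close> with more edges than \<open>g\<close> has no supergraph
        in \<open>g\<close>, so only small classes remain.\<close>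
      show "\<forall>F\<in>Pow X - {F. F \<subseteq> X \<and> class_of n F \<in> ?C}. \<psi> F = 0"
      proof
        fix F assume "F \<in> Pow X - {F. F \<subseteq> X \<and> class_of n F \<in> ?C}"
        then have F: "card F > class_edges g"
          using sub by (auto simp: class_of_in_iso_classes class_edges_class_of)
        have "\<not> F \<subseteq> K" if K: "K \<in> g" for K
        proof
          assume "F \<subseteq> K"
          moreover have "finite K"
            using K iso_class_subset[OF g] finite_simple_graph by blast
          ultimately have "card F \<le> card K" by (simp add: card_mono)
          then show False using F class_edges_eq[OF g K] by simp
        qed
        then have "{K \<in> g. F \<subseteq> K} = {}" by blast
        then show "\<psi> F = 0" unfolding \<psi>_def by (simp only: card.empty of_nat_0 mult_zero_right)
      qed
    qed (use fin in auto)
    also have "\<dots> = (\<Sum>F | F \<subseteq> X \<and> class_of n F \<in> ?C. \<phi> (class_of n F))"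
      using sub \<phi> by (intro sum.cong) auto
    also have "\<dots> = (\<Sum>c\<in>?C. real (class_count n c x) * \<phi> c)"
      using x by (intro sum_class_count[symmetric]) auto
    finally show ?thesis .
  qed
  then show thesis by (rule that)
qed

text \<open>A vertex permutation permutes the possible edges, hence commutes with
  complementation.\<close>

lemma graph_iso_complement:
  assumes "(nsets {..<n} 2 - X, nsets {..<n} 2 - Y) \<in> graph_iso n"
    and XY: "X \<in> simple_graphs n" "Y \<in> simple_graphs n"
  shows "(X, Y) \<in> graph_iso n"
proof -
  let ?E = "nsets {..<n} 2"
  obtain p where p: "p permutes {..<n}" "?E - Y = (\<lambda>e. p ` e) ` (?E - X)" "inj (\<lambda>e. p ` e)"
    using assms(1) by (rule graph_iso_imageE)
  have E: "(\<lambda>e. p ` e) ` ?E = ?E"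
  proof (rule card_subset_eq)
    show "(\<lambda>e. p ` e) ` ?E \<subseteq> ?E"
      using graph_iso_image[OF p(1), of ?E] by (simp add: simple_graphs_def)
    show "card ((\<lambda>e. p ` e) ` ?E) = card ?E"
      using p(3) by (intro card_image) (auto intro: inj_on_subset)
  qed (simp add: finite_imp_finite_nsets)
  have "Y = ?E - (?E - Y)" using XY by (auto simp: simple_graphs_def)
  also have "\<dots> = (\<lambda>e. p ` e) ` (?E - (?E - X))"
    using p(2) E image_set_diff[OF p(3)] by simp
  also have "?E - (?E - X) = X" using XY by (auto simp: simple_graphs_def)
  finally show ?thesis using p(1) XY by (auto simp: graph_iso_def)
qed

text \<open>A subgraph with as many edges as the whole graph is the whole graph.\<close>

lemma iso_class_eqI_of_subgraph:
  assumes x: "x \<in> iso_classes n" and y: "y \<in> iso_classes n" and "class_edges x = class_edges y"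
    and H: "H \<in> x" and Y: "Y \<in> y" and "H \<subseteq> Y"
  shows "x = y"
proof -
  have Ys: "Y \<in> simple_graphs n" using Y iso_class_subset[OF y] by blast
  have "H = Y"
    using assms class_edges_eq[OF x H] class_edges_eq[OF y Y] finite_simple_graph[OF Ys]
    by (intro card_subset_eq) auto
  then show ?thesis using class_of_eq_iff[OF x Ys] class_of_eq_iff[OF y Ys] H Y by simp
qed

text \<open>If \<open>x\<close> has few edges, it occurs in itself and hence in \<open>Y\<close>.
  Otherwise its complement has few edges, and the number of copies of this complement disjoint from
  a graph is a linear expression in known counts; a copy disjoint from \<open>Y\<close> must be the
  complement of \<open>Y\<close>.\<close>

lemma iso_class_determined_by_half_counts:
  assumes x: "x \<in> iso_classes n" and y: "y \<in> iso_classes n" and edges: "class_edges x = class_edges y"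
    and eq: "\<And>g. g \<in> iso_classes n \<Longrightarrow> class_edges g \<le> (n choose 2) div 2
      \<Longrightarrow> class_count n g x = class_count n g y"
  shows "x = y"
proof -
  let ?E = "nsets {..<n} 2" and ?m = "(n choose 2) div 2"
  obtain X Y where X: "X \<in> x" and Y: "Y \<in> y" using iso_class_nonempty x y by blast
  have XYs: "X \<in> simple_graphs n" "Y \<in> simple_graphs n" using X Y x y iso_class_subset by blast+
  then have XYE: "X \<subseteq> ?E" "Y \<subseteq> ?E" by (auto simp: simple_graphs_def)
  have fin: "finite X" "finite Y" "finite ?E"
    using finite_simple_graph XYs by (auto simp: finite_imp_finite_nsets)
  have cardXY: "card X = class_edges x" "card Y = class_edges x"
    using class_edges_eq X Y x y edges by auto
  show ?thesis
  proof (cases "class_edges x \<le> ?m")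
    case True
    then have "class_count n x y = class_count n x x" using eq x by simp
    also have "\<dots> > 0"
      using X class_count_eq_card[OF x x X] finite_iso_class[OF x] by (auto simp: card_gt_0_iff)
    finally have "{H \<in> x. H \<subseteq> Y} \<noteq> {}"
      unfolding class_count_eq_card[OF x y Y] by (metis card.empty less_irrefl)
    then show ?thesis using iso_class_eqI_of_subgraph[OF x y edges _ Y] by blast
  next
    case False
    let ?g = "class_of n (?E - X)"
    have gs: "?E - X \<in> simple_graphs n" by (auto simp: simple_graphs_def)
    have g: "?g \<in> iso_classes n" by (rule class_of_in_iso_classes[OF gs])
    have g_edges: "class_edges ?g = (n choose 2) - class_edges x"
      using class_edges_class_of[OF gs] XYE fin cardXY by (simp add: card_Diff_subset)
    obtain \<phi> where \<phi>: "\<And>x X. x \<in> iso_classes n \<Longrightarrow> X \<in> x \<Longrightarrow> real (card {K \<in> ?g. K \<inter> X = {}})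
      = (\<Sum>c | c \<in> iso_classes n \<and> class_edges c \<le> class_edges ?g. real (class_count n c x) * \<phi> c)"
      using complement_count_linear[OF g] by blast
    \<comment> \<open>With \<open>N = n choose 2\<close>, more than \<open>N div 2\<close> edges
      leave at most \<open>N - N div 2 - 1 \<le> N div 2\<close>.\<close>
    have "class_edges ?g \<le> ?m" using False g_edges by linarith
    \<comment> \<open>The weights \<open>\<phi>\<close> depend on \<open>?g\<close> alone, so
      \<open>X\<close> and \<open>Y\<close> obey the same formula.\<close>
    then have "real (card {K \<in> ?g. K \<inter> X = {}}) = real (card {K \<in> ?g. K \<inter> Y = {}})"
      unfolding \<phi>[OF x X] \<phi>[OF y Y] using eq by (intro sum.cong) auto
    moreover have "?E - X \<in> {K \<in> ?g. K \<inter> X = {}}"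
      using mem_class_of[OF gs] by blast
    then have "card {K \<in> ?g. K \<inter> X = {}} > 0"
      using finite_iso_class[OF g] by (auto simp: card_gt_0_iff)
    ultimately have "card {K \<in> ?g. K \<inter> Y = {}} > 0" by simp
    then have "{K \<in> ?g. K \<inter> Y = {}} \<noteq> {}" by (metis card.empty less_irrefl)
    then obtain K where K: "K \<in> ?g" "K \<inter> Y = {}" by blast
    have "K \<subseteq> ?E" using K(1) iso_class_subset[OF g] by (auto simp: simple_graphs_def)
    \<comment> \<open>\<open>K\<close> and \<open>?E - Y\<close> have the same number of edges,
      because \<open>x\<close> and \<open>y\<close> do.\<close>
    then have "K = ?E - Y"
      using K class_edges_eq[OF g K(1)] g_edges XYE fin cardXY
      by (intro card_subset_eq) (auto simp: card_Diff_subset)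
    then have "(?E - X, ?E - Y) \<in> graph_iso n"
      using class_rel[OF g mem_class_of[OF gs]] K(1) by simp
    then have "(X, Y) \<in> graph_iso n" by (rule graph_iso_complement[OF _ XYs])
    then have "X \<in> y" using mem_iso_class_iff[OF y Y] by blast
    then show ?thesis using class_of_eq_iff[OF x XYs(1)] class_of_eq_iff[OF y XYs(1)] X by simp
  qed
qed

section \<open>Graphs with at most one edge\<close>

text \<open>Any edge can be moved to any other by permuting vertices. There may be no edge at all,
  for instance when \<open>n = 1\<close>.\<close>

lemma card_edge_classes_1: "card (edge_classes n 1) \<le> 1"
proof -
  have "c = c'" if c: "c \<in> edge_classes n 1" and c': "c' \<in> edge_classes n 1" for c c'
  proof -
    have single: "\<exists>e\<in>nsets {..<n} 2. {e} \<in> c" if "c \<in> edge_classes n 1" for c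
    proof -
      note c = edge_classesD[OF that]
      obtain G where G: "G \<in> c" using iso_class_nonempty c(1) by blast
      have "card G = 1" using class_edges_eq[OF c(1) G] c(2) by simp
      then obtain e where "G = {e}" by (rule card_1_singletonE)
      then show ?thesis using G iso_class_subset[OF c(1)] by (auto simp: simple_graphs_def)
    qed
    obtain e e' where e: "e \<in> nsets {..<n} 2" "{e} \<in> c" and e': "e' \<in> nsets {..<n} 2" "{e'} \<in> c'"
      using single[OF c] single[OF c'] by blast
    obtain a b where ab: "e = {a, b}" "a < n" "b < n" "a \<noteq> b"
      using e(1) by (auto simp: nsets_2_eq)
    obtain u v where uv: "e' = {u, v}" "u < n" "v < n" "u \<noteq> v"
      using e'(1) by (auto simp: nsets_2_eq)
    \<comment> \<open>The first swap moves \<open>a\<close> to \<open>u\<close> and \<open>b\<close>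
      to \<open>transpose a u b\<close>; the second moves the latter to \<open>v\<close> and fixes
      \<open>u\<close>.\<close>
    define p where "p = transpose (transpose a u b) v \<circ> transpose a u"
    have "transpose a u b \<noteq> u" "transpose a u b < n" using ab uv by (auto simp: transpose_def)
    then have "p ` e = e'" using ab uv by (auto simp: p_def)
    moreover have "p permutes {..<n}"
      unfolding p_def using ab uv \<open>transpose a u b < n\<close>
      by (intro permutes_compose permutes_swap_id) auto
    ultimately have "({e}, {e'}) \<in> graph_iso n"
      using e(1) e'(1) by (auto simp: graph_iso_def simple_graphs_def)
    then have "{e} \<in> c'" using mem_iso_class_iff[OF edge_classesD(1)[OF c'] e'(2)] by blast
    then show "c = c'"
      using class_of_eq_iff[OF edge_classesD(1)[OF c]] class_of_eq_iff[OF edge_classesD(1)[OF c']] e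
      by (metis edge_classesD(1)[OF c] iso_class_subset subsetD)
  qed
  then show ?thesis by (auto simp: card_le_Suc0_iff_eq)
qed

text \<open>Makes the number of edges readable from the counts of \<open>edge_classes n 1\<close>,
  at the cost of at most one recorded count.\<close>

lemma sum_class_count_single_edge:
  assumes x: "x \<in> iso_classes n"
  shows "(\<Sum>c\<in>edge_classes n 1. real (class_count n c x)) = real (class_edges x)"
proof -
  obtain X where X: "X \<in> x" using iso_class_nonempty x by blast
  show ?thesis
    using sum_class_count_edge_classes[OF x X, of "\<lambda>_. 1" 1] class_edges_eq[OF x X] by simp
qed

text \<open>The members of \<open>g\<close> are empty graphs, contained in every graph. That the
  value does not depend on \<open>x\<close> starts the induction on the number of edges.\<close>

lemma class_count_edgeless:
  assumes g: "g \<in> edge_classes n 0" and x: "x \<in> iso_classes n"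
  shows "class_count n g x = card g"
proof -
  note g' = edge_classesD[OF g]
  obtain X where X: "X \<in> x" using iso_class_nonempty x by blast
  have "H = {}" if "H \<in> g" for H
    using class_edges_eq[OF g'(1) that] g'(2) finite_simple_graph that iso_class_subset[OF g'(1)]
    by fastforce
  then have "{H \<in> g. H \<subseteq> X} = g" by blast
  then show ?thesis using class_count_eq_card[OF g'(1) x X] by simp
qed

section \<open>Construction of the separator\<close>

text \<open>An injective count vector can be inverted on its range, so \<open>f\<close> recovers
  \<open>x\<close> and then counts \<open>g\<close> in it.\<close>

lemma is_separator_imp_is_generator:
  assumes "is_separator n S"
  shows "is_generator n S"
  unfolding is_generator_def
proof
  fix g assume "g \<in> iso_classes n"
  show "\<exists>f. \<forall>x\<in>iso_classes n. class_count n g x = f (count_vector n S x)"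
    using assms unfolding is_separator_def
    by (intro exI[of _ "\<lambda>v. class_count n g (inv_into (iso_classes n) (count_vector n S) v)"]) simp
qed

text \<open>Describes the columns to be recorded in the passage from \<open>k\<close> to
  \<open>k + 1\<close> edges. In the application \<open>u\<close> is the difference of the counts in
  two graphs with equally many edges and equal counts at level \<open>k\<close>.\<close>

definition complements_rows :: "nat \<Rightarrow> nat \<Rightarrow> graph set set \<Rightarrow> bool" where
  "complements_rows n k T \<longleftrightarrow> T \<subseteq> edge_classes n (Suc k)
    \<and> card T + card (edge_classes n k) = card (edge_classes n (Suc k))
    \<and> (\<forall>u. (\<forall>g\<in>edge_classes n k. (\<Sum>c\<in>edge_classes n (Suc k). real (class_count n g c) * u c) = 0)
      \<longrightarrow> (\<forall>c\<in>T. u c = 0) \<longrightarrow> (\<forall>c\<in>edge_classes n (Suc k). u c = 0))"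

lemma ex_complements_rows:
  assumes "2 * k < n choose 2"
  shows "\<exists>T. complements_rows n k T"
  unfolding complements_rows_def
  by (rule ex_determining_columns[OF finite_edge_classes finite_edge_classes
        class_count_rows_independent[OF assms]])

theorem theorem24:
  fixes n :: nat
  assumes "n \<ge> 1"
  shows "\<exists>S. S \<subseteq> iso_classes n \<and> card S \<le> num_classes n ((n choose 2) div 2) \<and>
    is_separator n S \<and> is_generator n S"
proof -
  let ?m = "(n choose 2) div 2"
  have "\<forall>k\<in>{..<?m}. \<exists>T. complements_rows n k T"
    using ex_complements_rows by auto
  then obtain T where T: "\<forall>k\<in>{..<?m}. complements_rows n k (T k)"
    by (auto dest: bchoice)
  \<comment> \<open>\<open>edge_classes n 1\<close> supplies the number of edges that Kelly's lemma
    needs; \<open>T k\<close> supplies the missing counts at level \<open>k + 1\<close>.\<close>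
  define S where "S = edge_classes n 1 \<union> (\<Union>k<?m. T k)"
  have S: "S \<subseteq> iso_classes n" using T by (fastforce simp: S_def complements_rows_def edge_classes_def)
  \<comment> \<open>The cardinality equations of \<open>complements_rows\<close> telescope.\<close>
  have "(\<Sum>k<j. card (T k)) + card (edge_classes n 0) = card (edge_classes n j)" if "j \<le> ?m" for j
    using that
  proof (induction j)
    case (Suc j)
    have "complements_rows n j (T j)" using T Suc.prems by simp
    then show ?case using Suc by (simp add: complements_rows_def)
  qed simp
  then have sum: "(\<Sum>k<?m. card (T k)) + card (edge_classes n 0) = card (edge_classes n ?m)" by simp
  \<comment> \<open>The edgeless class makes up for the single class that
    \<open>edge_classes n 1\<close> may contribute.\<close>
  have "class_of n {} \<in> edge_classes n 0"
    by (simp add: edge_classes_def simple_graphs_def class_of_in_iso_classes class_edges_class_of)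
  then have "card (edge_classes n 0) \<ge> 1"
    using finite_edge_classes by (auto simp: Suc_le_eq card_gt_0_iff)
  moreover have "card S \<le> card (edge_classes n 1) + (\<Sum>k<?m. card (T k))"
    unfolding S_def by (intro order.trans[OF card_Un_le] add_left_mono card_UN_le) simp
  ultimately have card: "card S \<le> num_classes n ?m"
    using sum card_edge_classes_1[of n] unfolding num_classes_eq by linarith
  have sep: "is_separator n S"
    unfolding is_separator_def
  proof (rule inj_onI)
    fix x y assume x: "x \<in> iso_classes n" and y: "y \<in> iso_classes n"
      and "count_vector n S x = count_vector n S y"
    then have eqS: "class_count n s x = class_count n s y" if "s \<in> S" for s
      using that unfolding count_vector_def by (metis restrict_apply')
    have "real (class_edges x) = real (class_edges y)"
      unfolding sum_class_count_single_edge[OF x, symmetric] sum_class_count_single_edge[OF y, symmetric]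
      using eqS by (intro sum.cong) (auto simp: S_def)
    then have edges: "class_edges x = class_edges y" by simp
    have counts: "\<forall>g\<in>edge_classes n j. class_count n g x = class_count n g y" if "j \<le> ?m" for j
      using that
    proof (induction j)
      case 0
      then show ?case using class_count_edgeless x y by simp
    next
      case (Suc k)
      define u where "u c = real (class_count n c x) - real (class_count n c y)" for c
      have "(\<Sum>c\<in>edge_classes n (Suc k). real (class_count n g c) * u c) = 0"
        \<comment> \<open>By Kelly's lemma the counts in \<open>x\<close> and in \<open>y\<close>
          give the same right-hand side, since the edge numbers and the counts at level
          \<open>k\<close> agree.\<close>
        if "g \<in> edge_classes n k" for g
        using sum_class_count_mult_class_count[OF that x] sum_class_count_mult_class_count[OF that y]
          Suc that edges
        by (simp add: u_def right_diff_distrib sum_subtractf)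
      moreover have "u c = 0" if "c \<in> T k" for c
        proof -
        have "c \<in> S" using that Suc.prems by (auto simp: S_def Suc_le_eq)
        then show ?thesis using eqS by (simp add: u_def)
      qed
      moreover have "complements_rows n k (T k)" using T Suc.prems by simp
      ultimately have "\<forall>c\<in>edge_classes n (Suc k). u c = 0"
        unfolding complements_rows_def by blast
      then show ?case by (simp add: u_def)
    qed
    show "x = y"
      using iso_class_determined_by_half_counts[OF x y edges] counts
      by (auto simp: edge_classes_def)
  qed
  show ?thesis
    using S card sep is_separator_imp_is_generator by blast
qed

end
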